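(* Let $p$ be a prime, $r\ge 1$, and let $\mathcal C$ be an $(n,k,\delta)$-convolutional code over $\mathbb Z_{p^r}$ with parameters $k_0,k_1,\dots,k_{r-1}$. Assume that $\mathcal C$ has a generator matrix $$\widetilde G(D)=\begin{bmatrix}\widetilde{\mathcal G}_0(D)\\ p\,\widetilde{\mathcal G}_1(D)\\ \vdots\\ p^{r-1}\widetilde{\mathcal G}_{r-1}(D)\end{bmatrix},\qquad \widetilde{\mathcal G}_i(D)\in\mathbb Z_{p^r}^{k_i\times n}[D],$$ such that the matrix $\widehat G(D)$ obtained by stacking $\widetilde{\mathcal G}_0(D),\widetilde{\mathcal G}_1(D),\dots,\widetilde{\mathcal G}_{r-1}(D)$ is full row rank and $\widehat G(0)$ is full row rank. Then, for every $j\in\mathbb N_0$, the $j$-th column distance of $\mathcal C$ satisfies $$d^c_j(\mathcal C)\le (j+1)\Bigl(n-\sum_{i=0}^{r-1}k_i\Bigr)+1 .$$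
   Context: Notation: $\mathcal A_p=\{0,1,\dots,p-1\}\subset\mathbb Z_{p^r}$; $\mathbb Z_{p^r}((D))$ is the ring of formal Laurent series; $\mathcal A_p((D))$ and $\mathcal A_p[D]$ are the sets of Laurent series and polynomials with coefficients in $\mathcal A_p$. A matrix over $\mathbb Z_{p^r}$ or over $\mathbb Z_{p^r}[D]$ is full row rank if its rows are linearly independent over $\mathbb Z_{p^r}$, respectively over $\mathbb Z_{p^r}((D))$. A $p$-linear combination of $v_1,\dots,v_k\in\mathbb Z_{p^r}^n[D]$ is a sum $\sum_j a_jv_j$ with $a_j\in\mathcal A_p[D]$; the set of all of these is the $p$-span. For vectors in $\mathbb Z_{p^r}^n$ the coefficients are taken in $\mathcal A_p$. An ordered set $(v_1,\dots,v_k)$ is a $p$-generator sequence if $p v_i$ is a $p$-linear combination of $v_{i+1},\dots,v_k$ for $i=1,\dots,k-1$, and $p v_k=0$. Vectors are $p$-linearly independent if the only $p$-linear combination of them equal to $0$ is the trivial one. A $p$-basis (of its $p$-span) is a $p$-generator sequence whose vectors are $p$-linearly independent. It is a reduced $p$-basis if the leading coefficient vectors (the coefficient vector of the highest power of $D$ in each $v_i(D)$) are $p$-linearly independent. A convolutional code $\mathcal C$ of length $n$ over $\mathbb Z_{p^r}$ is a $\mathbb Z_{p^r}((D))$-submodule of $\mathbb Z_{p^r}^n((D))$ of the form $\{u(D)\widetilde G(D):u(D)\in\mathbb Z_{p^r}^{\widetilde k}((D))\}$ for some polynomial matrix $\widetilde G(D)\in\mathbb Z_{p^r}^{\widetilde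 k\times n}[D]$, called a generator matrix of $\mathcal C$. A $p$-encoder of $\mathcal C$ is a matrix $G(D)\in\mathbb Z_{p^r}^{k\times n}[D]$ whose rows form a $p$-basis and such that $\mathcal C=\{u(D)G(D):u(D)\in\mathcal A_p^k((D))\}$; then $k$ is the $p$-dimension of $\mathcal C$. A $p$-encoder is delay-free if for all $u(D)\in\mathcal A_p^k((D))$ and $N\in\mathbb Z$, $\operatorname{supp}(u(D)G(D))\subset[N,\infty)$ implies $\operatorname{supp}(u(D))\subset[N,\infty)$ (equivalently, the rows of $G(0)$ are $p$-linearly independent). It is noncatastrophic if for all $u(D)\in\mathcal A_p^k((D))$, $u(D)G(D)\in\mathbb Z_{p^r}^n[D]$ implies $u(D)\in\mathcal A_p^k[D]$. A minimal $p$-encoder is a delay-free noncatastrophic $p$-encoder whose rows form a reduced $p$-basis. The $p$-degree of $\mathcal C$ is the sum of the row degrees of a minimal $p$-encoder. An $(n,k,\delta)$-convolutional code is a convolutional code of length $n$ that admits a noncatastrophic $p$-encoder (hence a minimal one), with $p$-dimension $k$ and $p$-degree $\delta$. Parameters: every convolutional code has a generator matrix obtained by stacking $\widetilde{\mathcal G}_0(D), p\widetilde{\mathcal G}_1(D),\dots,p^{r-1}\widetilde{\mathcal G}_{r-1}(D)$ (some blocks possibly empty) such that the stack of the $\widetilde{\mathcal G}_i(D)$ is full row rank. The numbers $k_i$ of rows of $\widetilde{\mathcal G}_i(D)$ are invariants of $\mathcal C$, called its parameters. Column distance: $\operatorname{wt}$ denotes Hamming weight (number of nonzero entries), and for $v(D)=\sum_i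 v_iD^i$, $\operatorname{wt}(v(D))=\sum_i \operatorname{wt}(v_i)$ and $v(D)|_{[0,j]}=\sum_{i=0}^{j}v_iD^i$. For a delay-free $p$-encoder $G(D)$ of $\mathcal C$, $$d^c_j(\mathcal C)=\min\{\operatorname{wt}(v(D)|_{[0,j]}): v(D)=u(D)G(D),\ u(D)=\sum_{i\ge0}u_iD^i\in\mathcal A_p^k((D)),\ u_0\ne0\},$$ which does not depend on the choice of delay-free $p$-encoder. *)

theory Defs
  imports
    "HOL-Computational_Algebra.Formal_Laurent_Series"
    "HOL-Computational_Algebra.Polynomial_FPS"
    "Jordan_Normal_Form.Matrix"
    "Berlekamp_Zassenhaus.Finite_Field"
begin

text \<open>
  The definitions are stated over an arbitrary commutative ring of coefficients \<open>'a\<close>, to be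
  instantiated with \<open>'q mod_ring\<close> where \<open>CARD('q) = p ^ r\<close>, i.e. with the integers modulo
  \<open>p ^ r\<close>.
\<close>

definition poly_to_fls :: "'a::comm_ring_1 poly \<Rightarrow> 'a fls" where
  "poly_to_fls q = fps_to_fls (fps_of_poly q)"

text \<open>The product of a row vector and a matrix, i.e. the linear combination of the rows of \<open>A\<close> with
  coefficients \<open>u\<close>.\<close>
definition row_mult :: "'a::comm_ring_1 vec \<Rightarrow> 'a mat \<Rightarrow> 'a vec" where
  "row_mult u A = transpose_mat A *\<^sub>v u"

definition full_row_rank :: "'a::comm_ring_1 mat \<Rightarrow> bool" where
  "full_row_rank A \<longleftrightarrow>
     (\<forall>u \<in> carrier_vec (dim_row A). row_mult u A = 0\<^sub>v (dim_col A) \<longrightarrow> u = 0\<^sub>v (dim_row A))"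

definition stack :: "nat \<Rightarrow> 'a mat list \<Rightarrow> 'a mat" where
  "stack n As = mat_of_rows n (concat (map rows As))"


subsection \<open>Coefficients restricted to \<open>0, \<dots>, p - 1\<close>\<close>

definition digits :: "nat \<Rightarrow> 'a::comm_ring_1 set" where
  "digits p = of_nat ` {..<p}"

definition digit_polys :: "nat \<Rightarrow> 'a::comm_ring_1 poly set" where
  "digit_polys p = {q. \<forall>i. poly.coeff q i \<in> digits p}"

definition digit_fls :: "nat \<Rightarrow> 'a::comm_ring_1 fls set" where
  "digit_fls p = {f. \<forall>i. fls_nth f i \<in> digits p}"

definition vecs_over :: "'a set \<Rightarrow> nat \<Rightarrow> 'a vec set" where
  "vecs_over S k = {v \<in> carrier_vec k. set\<^sub>v v \<subseteq> S}"


subsection \<open>\<open>p\<close>-bases\<close>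

text \<open>The coefficient set \<open>S\<close> is \<^term>\<open>digit_polys p\<close> for polynomial vectors and
  \<^term>\<open>digits p\<close> for constant vectors.\<close>

definition p_span :: "'a::comm_ring_1 set \<Rightarrow> nat \<Rightarrow> 'a vec list \<Rightarrow> 'a vec set" where
  "p_span S n vs = {row_mult a (mat_of_rows n vs) | a. a \<in> vecs_over S (length vs)}"

definition p_lin_indep :: "'a::comm_ring_1 set \<Rightarrow> nat \<Rightarrow> 'a vec list \<Rightarrow> bool" where
  "p_lin_indep S n vs \<longleftrightarrow>
     (\<forall>a \<in> vecs_over S (length vs).
        row_mult a (mat_of_rows n vs) = 0\<^sub>v n \<longrightarrow> a = 0\<^sub>v (length vs))"

text \<open>For the last index the list of remaining vectors is empty, so the condition reads
  \<open>p v\<^sub>k = 0\<close>. The presence of this last condition forces the sequence to be nonempty.\<close>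
definition p_generator_seq :: "nat \<Rightarrow> nat \<Rightarrow> 'a::comm_ring_1 poly vec list \<Rightarrow> bool" where
  "p_generator_seq p n vs \<longleftrightarrow>
     vs \<noteq> [] \<and> set vs \<subseteq> carrier_vec n \<and>
     (\<forall>i < length vs. of_nat p \<cdot>\<^sub>v (vs ! i) \<in> p_span (digit_polys p) n (drop (Suc i) vs))"

definition p_basis :: "nat \<Rightarrow> nat \<Rightarrow> 'a::comm_ring_1 poly vec list \<Rightarrow> bool" where
  "p_basis p n vs \<longleftrightarrow> p_generator_seq p n vs \<and> p_lin_indep (digit_polys p) n vs"

definition vec_degree :: "'a::comm_ring_1 poly vec \<Rightarrow> nat" where
  "vec_degree v = Max (degree ` set\<^sub>v v)"

definition leading_vec :: "'a::comm_ring_1 poly vec \<Rightarrow> 'a vec" where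
  "leading_vec v = map_vec (\<lambda>q. poly.coeff q (vec_degree v)) v"

definition reduced_p_basis :: "nat \<Rightarrow> nat \<Rightarrow> 'a::comm_ring_1 poly vec list \<Rightarrow> bool" where
  "reduced_p_basis p n vs \<longleftrightarrow>
     p_basis p n vs \<and> p_lin_indep (digits p) n (map leading_vec vs)"


subsection \<open>Convolutional codes\<close>

text \<open>Row combination of a polynomial matrix with Laurent series coefficients.\<close>
definition encode :: "'a::comm_ring_1 fls vec \<Rightarrow> 'a poly mat \<Rightarrow> 'a fls vec" where
  "encode u G = row_mult u (map_mat poly_to_fls G)"

definition generator_matrix :: "nat \<Rightarrow> 'a::comm_ring_1 fls vec set \<Rightarrow> 'a poly mat \<Rightarrow> bool" where
  "generator_matrix n C G \<longleftrightarrow>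
     dim_col G = n \<and> C = {encode u G | u. u \<in> carrier_vec (dim_row G)}"

text \<open>A set of this form is automatically a submodule.\<close>
definition conv_code :: "nat \<Rightarrow> 'a::comm_ring_1 fls vec set \<Rightarrow> bool" where
  "conv_code n C \<longleftrightarrow> (\<exists>G. generator_matrix n C G)"

text \<open>The matrix with blocks \<open>p ^ i * G i\<close> (\<open>i < r\<close>) generates \<open>C\<close>, and the matrix with blocks
  \<open>G i\<close> has full row rank over the Laurent series.\<close>
definition block_generator ::
  "nat \<Rightarrow> nat \<Rightarrow> nat \<Rightarrow> 'a::comm_ring_1 fls vec set \<Rightarrow> (nat \<Rightarrow> nat) \<Rightarrow> (nat \<Rightarrow> 'a poly mat) \<Rightarrow> bool"
  where
  "block_generator p r n C ks G \<longleftrightarrow>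
     (\<forall>i < r. G i \<in> carrier_mat (ks i) n) \<and>
     generator_matrix n C (stack n (map (\<lambda>i. of_nat (p ^ i) \<cdot>\<^sub>m G i) [0..<r])) \<and>
     full_row_rank (map_mat poly_to_fls (stack n (map G [0..<r])))"

definition has_parameters ::
  "nat \<Rightarrow> nat \<Rightarrow> nat \<Rightarrow> 'a::comm_ring_1 fls vec set \<Rightarrow> (nat \<Rightarrow> nat) \<Rightarrow> bool" where
  "has_parameters p r n C ks \<longleftrightarrow> (\<exists>G. block_generator p r n C ks G)"

definition p_encoder :: "nat \<Rightarrow> nat \<Rightarrow> 'a::comm_ring_1 fls vec set \<Rightarrow> 'a poly mat \<Rightarrow> bool" where
  "p_encoder p n C G \<longleftrightarrow>
     dim_col G = n \<and> p_basis p n (rows G) \<and>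
     C = {encode u G | u. u \<in> vecs_over (digit_fls p) (dim_row G)}"

definition coeff_vec :: "'a::comm_ring_1 fls vec \<Rightarrow> int \<Rightarrow> 'a vec" where
  "coeff_vec v i = map_vec (\<lambda>f. fls_nth f i) v"

definition supp :: "'a::comm_ring_1 fls vec \<Rightarrow> int set" where
  "supp v = {i. coeff_vec v i \<noteq> 0\<^sub>v (dim_vec v)}"

definition delay_free :: "nat \<Rightarrow> 'a::comm_ring_1 poly mat \<Rightarrow> bool" where
  "delay_free p G \<longleftrightarrow>
     (\<forall>u \<in> vecs_over (digit_fls p) (dim_row G). \<forall>N.
        supp (encode u G) \<subseteq> {N..} \<longrightarrow> supp u \<subseteq> {N..})"

definition noncatastrophic :: "nat \<Rightarrow> 'a::comm_ring_1 poly mat \<Rightarrow> bool" where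
  "noncatastrophic p G \<longleftrightarrow>
     (\<forall>u \<in> vecs_over (digit_fls p) (dim_row G).
        encode u G \<in> map_vec poly_to_fls ` carrier_vec (dim_col G) \<longrightarrow>
        u \<in> map_vec poly_to_fls ` vecs_over (digit_polys p) (dim_row G))"

definition minimal_p_encoder ::
  "nat \<Rightarrow> nat \<Rightarrow> 'a::comm_ring_1 fls vec set \<Rightarrow> 'a poly mat \<Rightarrow> bool" where
  "minimal_p_encoder p n C G \<longleftrightarrow>
     p_encoder p n C G \<and> delay_free p G \<and> noncatastrophic p G \<and> reduced_p_basis p n (rows G)"

definition has_p_dimension :: "nat \<Rightarrow> nat \<Rightarrow> 'a::comm_ring_1 fls vec set \<Rightarrow> nat \<Rightarrow> bool" where
  "has_p_dimension p n C k \<longleftrightarrow> (\<exists>G. p_encoder p n C G \<and> dim_row G = k)"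

definition has_p_degree :: "nat \<Rightarrow> nat \<Rightarrow> 'a::comm_ring_1 fls vec set \<Rightarrow> nat \<Rightarrow> bool" where
  "has_p_degree p n C d \<longleftrightarrow>
     (\<exists>G. minimal_p_encoder p n C G \<and> (\<Sum>v\<leftarrow>rows G. vec_degree v) = d)"

text \<open>An \<open>(n, k, d)\<close>-convolutional code.\<close>
definition nkd_conv_code ::
  "nat \<Rightarrow> nat \<Rightarrow> nat \<Rightarrow> nat \<Rightarrow> 'a::comm_ring_1 fls vec set \<Rightarrow> bool" where
  "nkd_conv_code p n k d C \<longleftrightarrow>
     conv_code n C \<and>
     (\<exists>G. p_encoder p n C G \<and> noncatastrophic p G) \<and>
     has_p_dimension p n C k \<and> has_p_degree p n C d"


subsection \<open>Column distances\<close>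

definition hamming_wt :: "'a::comm_ring_1 vec \<Rightarrow> nat" where
  "hamming_wt v = card {i. i < dim_vec v \<and> vec_index v i \<noteq> 0}"

text \<open>The weight of the truncation of \<open>v\<close> to the powers \<open>0, \<dots>, j\<close>.\<close>
definition truncated_wt :: "nat \<Rightarrow> 'a::comm_ring_1 fls vec \<Rightarrow> nat" where
  "truncated_wt j v = (\<Sum>i\<le>j. hamming_wt (coeff_vec v (int i)))"

definition encoder_column_distance :: "nat \<Rightarrow> 'a::comm_ring_1 poly mat \<Rightarrow> nat \<Rightarrow> nat" where
  "encoder_column_distance p G j =
     (LEAST w. \<exists>u \<in> vecs_over (digit_fls p) (dim_row G).
        supp u \<subseteq> {0..} \<and> coeff_vec u 0 \<noteq> 0\<^sub>v (dim_row G) \<and> w = truncated_wt j (encode u G))"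

text \<open>The value does not depend on the chosen delay-free \<open>p\<close>-encoder.\<close>
definition column_distance ::
  "nat \<Rightarrow> nat \<Rightarrow> 'a::comm_ring_1 fls vec set \<Rightarrow> nat \<Rightarrow> nat" where
  "column_distance p n C j =
     encoder_column_distance p (SOME G. p_encoder p n C G \<and> delay_free p G) j"

end

theory Submission
  imports Defs
begin

text \<open>
  Write \<open>R\<close> for the integers modulo \<open>p ^ r\<close>, \<open>H\<close> for the stack of the unscaled blocks \<open>G i\<close>,
  \<open>K\<close> for its number of rows, and \<open>\<pi> = p ^ (r - 1)\<close>. The bound comes from a single codeword.

  Every element of \<open>R\<close> is a unit or is annihilated by \<open>\<pi>\<close>, so row reduction works as over a
  field: since the rows of \<open>H(0)\<close> are independent, \<open>K\<close> columns of \<open>H(0)\<close> form an invertible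
  matrix. A power series matrix with invertible constant term is invertible, so the same set
  \<open>S\<close> of \<open>K\<close> columns is an information set for all of \<open>H(D)\<close>: every vector of power series
  on \<open>S\<close> is the restriction to \<open>S\<close> of some \<open>x(D) H(D)\<close>
  (\<open>information_set_exists\<close>).

  Take \<open>x\<close> such that \<open>x H\<close> equals \<open>1\<close> at one position \<open>c0\<close> of \<open>S\<close> and \<open>0\<close> at the others, and put
  \<open>v = \<pi> x H\<close>. The factor \<open>\<pi>\<close> supplies the power \<open>p ^ i\<close> that the generator matrix has in
  front of each block, so \<open>v\<close> is a codeword (\<open>multiple_in_block_code\<close>). On \<open>S\<close>, the only nonzero
  coefficient of \<open>v\<close> is the constant \<open>\<pi>\<close> at \<open>c0\<close>. The \<open>n - K\<close> positions outside \<open>S\<close> contribute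
  at most \<open>1\<close> each per time instant, so the weight of \<open>v\<close> on \<open>[0, j]\<close> is at most
  \<open>(j + 1) (n - K) + 1\<close>.

  Finally, \<open>v\<close> has no negative powers of \<open>D\<close> and a nonzero constant coefficient. With respect to
  a delay-free \<open>p\<close>-encoder, its input then also starts exactly at time \<open>0\<close>
  (\<open>leading_input_nonzero\<close>), so \<open>v\<close> competes in the minimum that defines the column distance. If
  \<open>K = 0\<close> there is no \<open>c0\<close>, and the bound is the trivial one \<open>(j + 1) n + 1\<close>.
\<close>

section \<open>Units in the integers modulo a prime power\<close>

unbundle no Formal_Power_Series.fps_syntax
unbundle no Formal_Laurent_Series.fps_syntax

text \<open>An integer divisible by \<open>p\<close> is killed by \<open>p ^ (r - 1)\<close>; any other integer is coprime to
  \<open>p ^ r\<close>, and a Bezout coefficient is its inverse. This dichotomy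
  replaces the one between zero and nonzero elements of a field when pivots are chosen.\<close>
lemma mod_ring_unit_or_annihilated:
  fixes x :: "'q::nontriv mod_ring"
  assumes "prime p" and "r \<ge> 1" and card: "CARD('q) = p ^ r"
  shows "(\<exists>y. x * y = 1) \<or> of_nat (p ^ (r - 1)) * x = 0"
proof -
  have zero: "(of_int (int (p ^ r)) :: 'q mod_ring) = 0"
    using of_nat_card_eq_0[where 'a='q] by (simp add: card)
  define m where "m = to_int_mod_ring x"
  have x: "x = of_int m"
    unfolding m_def by (simp add: of_int_of_int_mod_ring)
  show ?thesis
  proof (cases "int p dvd m")
    case True
    then obtain l where "m = int p * l" by (elim dvdE)
    moreover have "p ^ (r - 1) * p = p ^ r"
      using \<open>r \<ge> 1\<close> by (cases r) auto
    ultimately have "int (p ^ (r - 1)) * m = int (p ^ r) * l"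
      by (metis mult.assoc of_nat_mult)
    then have "(of_int (int (p ^ (r - 1)) * m) :: 'q mod_ring) = of_int (int (p ^ r)) * of_int l"
      by (metis of_int_mult)
    then show ?thesis
      using zero x by simp
  next
    case False
    then have "coprime m (int (p ^ r))"
      using \<open>prime p\<close> using prime_imp_coprime[of "int p" m]
      by (simp add: coprime_commute)
    then obtain a b where "a * m + b * int (p ^ r) = 1"
      using bezout_int[of m "int (p ^ r)"] by (auto simp: coprime_iff_gcd_eq_1)
    then have "(of_int (a * m + b * int (p ^ r)) :: 'q mod_ring) = 1"
      by simp
    then have "x * of_int a = 1"
      using zero x by (simp add: mult.commute)
    then show ?thesis by blast
  qed
qed

lemma mod_ring_prime_power_nonzero:
  assumes "prime p" and "r \<ge> 1" and card: "CARD('q::nontriv) = p ^ r"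
  shows "(of_nat (p ^ (r - 1)) :: 'q mod_ring) \<noteq> 0"
proof -
  have "p ^ (r - 1) < CARD('q)"
    using assms prime_gt_1_nat[of p] by (simp add: card)
  then have "to_int_mod_ring (of_nat (p ^ (r - 1)) :: 'q mod_ring) = int (p ^ (r - 1))"
    by (simp add: of_nat_of_int_mod_ring del: of_nat_power)
  then have "to_int_mod_ring (of_nat (p ^ (r - 1)) :: 'q mod_ring) \<noteq> 0"
    using prime_gt_0_nat[OF \<open>prime p\<close>] by simp
  then show ?thesis
    by (metis to_int_mod_ring_hom.hom_zero)
qed

section \<open>Information sets\<close>

text \<open>Gaussian elimination, one row at a time. An information set \<open>S\<close> for the first \<open>K\<close> rows
  allows subtracting from row \<open>K\<close> a combination of the earlier rows so that the remainder \<open>b\<close>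
  vanishes on \<open>S\<close>. Some entry of \<open>b\<close> has a unit as constant coefficient: otherwise \<open>\<pi>\<close> would
  annihilate \<open>b(0)\<close>, which is a dependence among the rows of the constant matrix with the nonzero
  coefficient \<open>\<pi>\<close> at row \<open>K\<close>. That entry is invertible as a power series, and its column joins
  \<open>S\<close>. Since a power series is a unit as soon as its constant coefficient is one, independence of
  constant coefficients has consequences for power series combinations.\<close>
lemma information_set_exists:
  fixes a :: "nat \<Rightarrow> nat \<Rightarrow> 'a::comm_ring_1 fps" and \<pi> :: 'a
  assumes "\<pi> \<noteq> 0" and unit_or: "\<And>x. (\<exists>y. x * y = 1) \<or> \<pi> * x = 0"
    and indep: "\<And>x. (\<And>c. c < n \<Longrightarrow> (\<Sum>t<K. x t * fps_nth (a t c) 0) = 0) \<Longrightarrow> (\<forall>t<K. x t = 0)"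
  shows "\<exists>S \<subseteq> {..<n}. card S = K \<and> (\<forall>w. \<exists>x. \<forall>c\<in>S. (\<Sum>t<K. x t * a t c) = w c)"
  using indep
proof (induction K)
  case 0
  show ?case by (intro exI[of _ "{}"]) auto
next
  case (Suc K)
  have "\<forall>t<K. x t = 0" if "\<And>c. c < n \<Longrightarrow> (\<Sum>t<K. x t * fps_nth (a t c) 0) = 0" for x
    using Suc.prems[of "x(K := 0)"] that
    by (auto simp: lessThan_Suc dest: less_SucI split: if_splits)
  then obtain S where S: "S \<subseteq> {..<n}" "card S = K"
    and hit: "\<And>w. \<exists>x. \<forall>c\<in>S. (\<Sum>t<K. x t * a t c) = w c"
    using Suc.IH by blast
  obtain y where y: "\<And>c. c \<in> S \<Longrightarrow> (\<Sum>t<K. y t * a t c) = a K c"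
    using hit[of "a K"] by blast
  define b where "b c = a K c - (\<Sum>t<K. y t * a t c)" for c
  have bS: "b c = 0" if "c \<in> S" for c
    using y[OF that] by (simp add: b_def)
  have "\<exists>c<n. \<pi> * fps_nth (b c) 0 \<noteq> 0"
  proof (rule ccontr)
    assume none: "\<not> ?thesis"
    define z where "z t = (if t = K then \<pi> else - (\<pi> * fps_nth (y t) 0))" for t
    have "(\<Sum>t<Suc K. z t * fps_nth (a t c) 0) = \<pi> * fps_nth (b c) 0" for c
      by (simp add: z_def b_def fps_sum_nth algebra_simps sum_distrib_left sum_negf)
    then have "\<forall>t<Suc K. z t = 0"
      using none by (intro Suc.prems) auto
    then show False
      using \<open>\<pi> \<noteq> 0\<close> by (auto simp: z_def)
  qed
  then obtain c0 i where c0: "c0 < n" "\<pi> * fps_nth (b c0) 0 \<noteq> 0" and "fps_nth (b c0) 0 * i = 1"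
    using unit_or by blast
  then have inv: "b c0 * fps_right_inverse (b c0) i = 1"
    by (intro fps_right_inverse)
  have "c0 \<notin> S"
    using c0(2) bS by auto
  moreover have "\<exists>x. \<forall>c\<in>insert c0 S. (\<Sum>t<Suc K. x t * a t c) = w c" for w
  proof -
    obtain x where x: "\<And>c. c \<in> S \<Longrightarrow> (\<Sum>t<K. x t * a t c) = w c"
      using hit by blast
    define s where "s = (w c0 - (\<Sum>t<K. x t * a t c0)) * fps_right_inverse (b c0) i"
    define x' where "x' t = (if t = K then s else x t - s * y t)" for t
    have x': "(\<Sum>t<Suc K. x' t * a t c) = (\<Sum>t<K. x t * a t c) + s * b c" for c
      by (simp add: x'_def b_def algebra_simps sum_distrib_left sum_subtractf)
    have "s * b c0 = w c0 - (\<Sum>t<K. x t * a t c0)"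
      using inv 
      by (simp add: s_def mult.assoc mult.commute[of "fps_right_inverse (b c0) i"])
    then have "\<forall>c\<in>insert c0 S. (\<Sum>t<Suc K. x' t * a t c) = w c"
      unfolding x' using x bS by auto
    then show ?thesis by blast
  qed
  moreover have "finite S"
    using S(1) finite_subset by blast
  ultimately show ?case
    using S c0(1) by (intro exI[of _ "insert c0 S"]) auto
qed

section \<open>Codewords and inputs of delay-free encoders\<close>

lemma encode_index:
  assumes "c < dim_col G" and "u \<in> carrier_vec (dim_row G)"
  shows "encode u G $ c = (\<Sum>t<dim_row G. u $ t * poly_to_fls (G $$ (t, c)))"
  using assms
  by (auto simp: encode_def row_mult_def scalar_prod_def lessThan_atLeast0 mult.commute
      intro!: sum.cong)

lemma dim_encode [simp]: "dim_vec (encode u G) = dim_col G"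
  by (simp add: encode_def row_mult_def)

lemma fps_to_fls_sum: "fps_to_fls (\<Sum>t\<in>A. f t) = (\<Sum>t\<in>A. fps_to_fls (f t))"
  by (induction A rule: infinite_finite_induct) auto

text \<open>Delay-freeness forces the input to start no earlier than the output. It cannot start later
  either, since encoding with a polynomial matrix creates no powers of \<open>D\<close> below those of the
  input.\<close>
lemma leading_input_nonzero:
  assumes "delay_free p G" and u: "u \<in> vecs_over (digit_fls p) (dim_row G)"
    and supp: "supp (encode u G) \<subseteq> {0..}"
    and nz: "coeff_vec (encode u G) 0 \<noteq> 0\<^sub>v (dim_col G)"
  shows "supp u \<subseteq> {0..}" and "coeff_vec u 0 \<noteq> 0\<^sub>v (dim_row G)"
proof -
  show supp_u: "supp u \<subseteq> {0..}"
    using assms by (auto simp: delay_free_def)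
  have car: "u \<in> carrier_vec (dim_row G)"
    using u by (simp add: vecs_over_def)
  show "coeff_vec u 0 \<noteq> 0\<^sub>v (dim_row G)"
  proof
    assume 0: "coeff_vec u 0 = 0\<^sub>v (dim_row G)"
    have u0: "fls_nth (u $ t) i = 0" if "t < dim_row G" "i \<le> 0" for t i
    proof -
      have "coeff_vec u i = 0\<^sub>v (dim_row G)"
        using supp_u 0 that(2) car by (cases "i = 0") (auto simp: supp_def)
      then show ?thesis
        using that car by (metis carrier_vecD coeff_vec_def index_map_vec(1) index_zero_vec(1))
    qed
    have "fls_nth (u $ t * poly_to_fls q) 0 = 0" if t: "t < dim_row G" for t q
    proof -
      have ut: "u $ t = fps_to_fls (fls_regpart (u $ t))"
        using u0[OF t] by (intro fls_eqI) auto
      show ?thesis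
        using u0[OF t, of 0]
        by (subst ut) (simp add: poly_to_fls_def flip: fls_times_fps_to_fls)
    qed
    then have "coeff_vec (encode u G) 0 = 0\<^sub>v (dim_col G)"
      using car by (intro eq_vecI) (auto simp: coeff_vec_def encode_index fls_nth_sum)
    then show False
      using nz by simp
  qed
qed

lemma encoder_column_distance_le:
  assumes enc: "p_encoder p n C G" and df: "delay_free p G"
    and v: "v \<in> C" "supp v \<subseteq> {0..}" "coeff_vec v 0 \<noteq> 0\<^sub>v n"
  shows "encoder_column_distance p G j \<le> truncated_wt j v"
proof -
  obtain u where u: "u \<in> vecs_over (digit_fls p) (dim_row G)" "v = encode u G"
    using enc v(1) by (auto simp: p_encoder_def)
  have "dim_col G = n"
    using enc by (simp add: p_encoder_def)
  then show ?thesis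
    unfolding encoder_column_distance_def
    using leading_input_nonzero[OF df u(1)] u v by (intro Least_le) auto
qed

text \<open>The input that is \<open>1\<close> in the first row and \<open>0\<close> elsewhere is admissible, because a
  \<open>p\<close>-basis is nonempty and \<open>0\<close> and \<open>1\<close> are digits; a truncated word has at most \<open>(j + 1) * n\<close>
  coefficients.\<close>
lemma encoder_column_distance_le_length:
  assumes "prime p" and enc: "p_encoder p n (C :: 'a::comm_ring_1 fls vec set) G"
  shows "encoder_column_distance p G j \<le> (j + 1) * n"
proof -
  define k where "k = dim_row G"
  have "rows G \<noteq> []"
    using enc by (simp add: p_encoder_def p_basis_def p_generator_seq_def)
  then have "k > 0"
    by (auto simp: k_def rows_def)
  define u :: "'a fls vec" where "u = unit_vec k 0"
  have "{0, 1} \<subseteq> (digits p :: 'a set)"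
    using prime_gt_1_nat[OF \<open>prime p\<close>]
    by (auto simp: digits_def image_iff intro: bexI[of _ 0] bexI[of _ 1])
  then have "u \<in> vecs_over (digit_fls p) k"
    by (auto simp: u_def vecs_over_def vec_set_def unit_vec_def digit_fls_def)
  moreover have "supp u \<subseteq> {0..}"
    by (force simp: supp_def u_def coeff_vec_def unit_vec_def)
  moreover have "coeff_vec u 0 \<noteq> 0\<^sub>v k"
  proof
    assume "coeff_vec u 0 = 0\<^sub>v k"
    then have "coeff_vec u 0 $ 0 = 0"
      using \<open>k > 0\<close> by simp
    then show False
      using \<open>k > 0\<close> by (simp add: coeff_vec_def u_def)
  qed
  ultimately have "encoder_column_distance p G j \<le> truncated_wt j (encode u G)"
    unfolding encoder_column_distance_def k_def by (intro Least_le) auto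
  also have "\<dots> \<le> (\<Sum>i\<le>j. n)"
    unfolding truncated_wt_def
  proof (intro sum_mono)
    fix i
    have "hamming_wt (coeff_vec (encode u G) (int i)) \<le> card {..<dim_col G}"
      unfolding hamming_wt_def by (intro card_mono) (auto simp: coeff_vec_def)
    then show "hamming_wt (coeff_vec (encode u G) (int i)) \<le> n"
      using enc by (simp add: p_encoder_def)
  qed
  finally show ?thesis by simp
qed

section \<open>Codewords of a block generator matrix\<close>

lemma concat_rows_smult:
  "list_all2 (\<lambda>v w. \<exists>i\<in>set is. v = c i \<cdot>\<^sub>v w)
     (concat (map (\<lambda>i. rows (c i \<cdot>\<^sub>m A i)) is)) (concat (map (\<lambda>i. rows (A i)) is))"
proof (induction "is")
  case (Cons i "is")
  have "list_all2 (\<lambda>v w. v = c i \<cdot>\<^sub>v w) (rows (c i \<cdot>\<^sub>m A i)) (rows (A i))"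
    by (auto simp: list_all2_conv_all_nth)
  then show ?case
    using Cons by (auto intro!: list_all2_appendI elim!: list_all2_mono)
qed simp

text \<open>A row of block \<open>i\<close> appears in the generator matrix multiplied by \<open>p ^ i\<close>, where
  \<open>i \<le> r - 1\<close>, so multiplying the corresponding input by \<open>p ^ (r - 1 - i)\<close> gives the common
  factor \<open>p ^ (r - 1)\<close>.\<close>
lemma multiple_in_block_code:
  fixes G :: "nat \<Rightarrow> 'a::comm_ring_1 poly mat"
  assumes block: "block_generator p r n C ks G" and car: "x \<in> carrier_vec (\<Sum>i<r. ks i)"
  shows "of_nat (p ^ (r - 1)) \<cdot>\<^sub>v encode x (stack n (map G [0..<r])) \<in> C"
proof -
  define L where "L = concat (map (\<lambda>i. rows (of_nat (p ^ i) \<cdot>\<^sub>m G i)) [0..<r])"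
  define M where "M = concat (map (\<lambda>i. rows (G i)) [0..<r])"
  define H where "H = stack n (map G [0..<r])"
  have H: "H = mat_of_rows n M"
    by (simp add: H_def stack_def M_def o_def)
  have gen: "C = {encode u (mat_of_rows n L) | u. u \<in> carrier_vec (length L)}"
    using block by (simp add: block_generator_def generator_matrix_def stack_def L_def o_def)
  have dims: "length M = (\<Sum>i<r. ks i)"
    using block
    by (auto simp: M_def length_concat o_def block_generator_def interv_sum_list_conv_sum_set_nat
        lessThan_atLeast0 intro!: sum.cong)
  have set_M: "set M \<subseteq> carrier_vec n"
    using block by (fastforce simp: M_def block_generator_def rows_def)
  have LM: "list_all2 (\<lambda>v w. \<exists>i<r. v = of_nat (p ^ i) \<cdot>\<^sub>v w) L M"
    using concat_rows_smult[of "[0..<r]" "\<lambda>i. of_nat (p ^ i)" G]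
    unfolding L_def M_def by (rule list_all2_mono) auto
  then have len: "length L = length M"
    by (rule list_all2_lengthD)
  \<comment> \<open>\<open>e t\<close> is the index of the block that contains row \<open>t\<close> of the stack.\<close>
  from LM obtain e where
    e: "\<And>t. t < length M \<Longrightarrow> e t < r \<and> L ! t = of_nat (p ^ e t) \<cdot>\<^sub>v M ! t"
    using len unfolding list_all2_conv_all_nth by metis
  define u where "u = vec (length M) (\<lambda>t. of_nat (p ^ (r - 1 - e t)) * x $ t)"
  have entry: "u $ t * poly_to_fls (mat_of_rows n L $$ (t, c)) =
      of_nat (p ^ (r - 1)) * (x $ t * poly_to_fls (mat_of_rows n M $$ (t, c)))"
    if "t < length M" "c < n" for t c
  proof -
    have "M ! t \<in> carrier_vec n"
      using set_M that(1) by auto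
    then have "mat_of_rows n L $$ (t, c) = of_nat (p ^ e t) * mat_of_rows n M $$ (t, c)"
      using that e[OF that(1)] by (simp add: len mat_of_rows_index)
    moreover have "poly_to_fls (of_nat m * q) = of_nat m * poly_to_fls q" for m and q :: "'a poly"
      by (induction m)
        (simp_all add: poly_to_fls_def distrib_right fps_of_poly_add)
    moreover have "(of_nat (p ^ (r - 1 - e t)) * of_nat (p ^ e t) :: 'a fls) = of_nat (p ^ (r - 1))"
      using e[OF that(1)] by (simp flip: of_nat_mult power_add)
    moreover have "u $ t = of_nat (p ^ (r - 1 - e t)) * x $ t"
      using that(1) by (simp add: u_def)
    ultimately show ?thesis
      by (metis (no_types, lifting) mult.assoc mult.left_commute)
  qed
  have "of_nat (p ^ (r - 1)) \<cdot>\<^sub>v encode x H = encode u (mat_of_rows n L)"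
  proof (intro eq_vecI)
    fix c
    assume "c < dim_vec (encode u (mat_of_rows n L))"
    then have "c < n" by simp
    have "(of_nat (p ^ (r - 1)) \<cdot>\<^sub>v encode x H) $ c =
        of_nat (p ^ (r - 1)) * (\<Sum>t<length M. x $ t * poly_to_fls (mat_of_rows n M $$ (t, c)))"
      using \<open>c < n\<close> car by (simp add: H encode_index dims)
    also have "\<dots> = (\<Sum>t<length M. u $ t * poly_to_fls (mat_of_rows n L $$ (t, c)))"
      unfolding sum_distrib_left using \<open>c < n\<close>
      by (intro sum.cong refl) (simp only: lessThan_iff entry)
    also have "\<dots> = encode u (mat_of_rows n L) $ c"
      using \<open>c < n\<close> by (subst encode_index) (simp_all add: u_def len)
    finally show "(of_nat (p ^ (r - 1)) \<cdot>\<^sub>v encode x H) $ c = encode u (mat_of_rows n L) $ c" .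
  qed (simp add: H)
  moreover have "u \<in> carrier_vec (length L)"
    by (simp add: u_def len)
  ultimately show ?thesis
    unfolding gen H_def by blast
qed

section \<open>The bound on the column distances\<close>

theorem theorem19:
  fixes p r n k \<delta> :: nat
    and ks :: "nat \<Rightarrow> nat"
    and C :: "'q::nontriv mod_ring fls vec set"
    and G :: "nat \<Rightarrow> 'q mod_ring poly mat"
  assumes "prime p" and "r \<ge> 1" and "CARD('q) = p ^ r"
    and "nkd_conv_code p n k \<delta> C"
    and "has_parameters p r n C ks"
    and "block_generator p r n C ks G"
    and "full_row_rank (map_mat (\<lambda>q. poly q 0) (stack n (map G [0..<r])))"
  shows "\<forall>j. int (column_distance p n C j) \<le>
           (int j + 1) * (int n - (\<Sum>i<r. int (ks i))) + 1"
proof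
  fix j
  define K where "K = (\<Sum>i<r. ks i)"
  define H where "H = stack n (map G [0..<r])"
  define \<pi> :: "'q mod_ring" where "\<pi> = of_nat (p ^ (r - 1))"
  have \<pi>: "\<pi> \<noteq> 0"
    unfolding \<pi>_def by (rule mod_ring_prime_power_nonzero) fact+
  define E where "E = (SOME E. p_encoder p n C E \<and> delay_free p E)"
  have "\<exists>E. p_encoder p n C E \<and> delay_free p E"
    using assms(4) by (auto simp: nkd_conv_code_def has_p_degree_def minimal_p_encoder_def)
  then have E: "p_encoder p n C E" "delay_free p E"
    unfolding E_def by (metis (mono_tags, lifting) someI_ex)+
  have cd: "column_distance p n C j = encoder_column_distance p E j"
    by (simp add: column_distance_def E_def)
  have H: "dim_row H = K" "dim_col H = n"
    using assms(6)
    by (auto simp: H_def stack_def K_def length_concat o_def block_generator_def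
        interv_sum_list_conv_sum_set_nat lessThan_atLeast0 intro!: sum.cong)
  define a where "a t c = fps_of_poly (H $$ (t, c))" for t c
  have "\<forall>t<K. x t = 0" if x: "\<And>c. c < n \<Longrightarrow> (\<Sum>t<K. x t * fps_nth (a t c) 0) = 0" for x
  proof -
    have "row_mult (vec K x) (map_mat (\<lambda>q. poly q 0) H) = 0\<^sub>v n"
      using x by (intro eq_vecI)
        (auto simp: row_mult_def scalar_prod_def H a_def poly_0_coeff_0 lessThan_atLeast0 mult.commute)
    then have "vec K x = 0\<^sub>v K"
      using assms(7) by (simp add: full_row_rank_def H flip: H_def)
    then show ?thesis
      by (metis index_vec index_zero_vec(1))
  qed
  then have "\<exists>S \<subseteq> {..<n}. card S = K \<and> (\<forall>w. \<exists>x. \<forall>c\<in>S. (\<Sum>t<K. x t * a t c) = w c)"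
    by (rule information_set_exists[OF \<pi> mod_ring_unit_or_annihilated[OF assms(1-3), folded \<pi>_def]])
  then obtain S where S: "S \<subseteq> {..<n}" "card S = K"
    and hit: "\<And>w. \<exists>x. \<forall>c\<in>S. (\<Sum>t<K. x t * a t c) = w c"
    by blast
  have fin: "finite S" and "K \<le> n"
    using S by (auto intro: finite_subset dest: card_mono[rotated])
  have "column_distance p n C j \<le> (j + 1) * (n - K) + 1"
  proof (cases "K = 0")
    case True
    then show ?thesis
      using encoder_column_distance_le_length[OF assms(1) E(1), of j] by (simp add: cd)
  next
    case False
    then obtain c0 where "c0 \<in> S"
      using S by fastforce
    then have "c0 < n"
      using S by auto
    obtain x where x: "\<And>c. c \<in> S \<Longrightarrow> (\<Sum>t<K. x t * a t c) = (if c = c0 then 1 else 0)"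
      using hit[of "\<lambda>c. if c = c0 then 1 else 0"] by blast
    define v where "v = of_nat (p ^ (r - 1)) \<cdot>\<^sub>v encode (vec K (\<lambda>t. fps_to_fls (x t))) H"
    have "v \<in> C"
      unfolding v_def H_def by (rule multiple_in_block_code) (use assms(6) in \<open>auto simp: K_def\<close>)
    have dim: "dim_vec v = n"
      by (simp add: v_def H)
    have v: "v $ c = fps_to_fls (fps_const \<pi> * (\<Sum>t<K. x t * a t c))" if "c < n" for c
    proof -
      have "(of_nat (p ^ (r - 1)) :: 'q mod_ring fls) = fps_to_fls (fps_const \<pi>)"
        by (simp add: \<pi>_def fls_of_nat)
      moreover have "encode (vec K (\<lambda>t. fps_to_fls (x t))) H $ c = fps_to_fls (\<Sum>t<K. x t * a t c)"
        using that by (simp add: encode_index H fps_to_fls_sum fls_times_fps_to_fls poly_to_fls_def a_def)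
      ultimately show ?thesis
        using that by (simp add: v_def H fls_times_fps_to_fls)
    qed
    have vS: "fls_nth (v $ c) (int i) = (if c = c0 \<and> i = 0 then \<pi> else 0)" if "c \<in> S" for c i
      using that S x[OF that] by (subst v) auto
    have "supp v \<subseteq> {0..}"
      by (force simp: supp_def coeff_vec_def dim v)
    moreover have "coeff_vec v 0 $ c0 = \<pi>"
      using vS[OF \<open>c0 \<in> S\<close>, of 0] \<open>c0 < n\<close> by (simp add: coeff_vec_def dim)
    then have "coeff_vec v 0 \<noteq> 0\<^sub>v n"
      using \<pi> \<open>c0 < n\<close> by auto
    ultimately have "column_distance p n C j \<le> truncated_wt j v"
      unfolding cd using \<open>v \<in> C\<close> by (intro encoder_column_distance_le[OF E])
    also have "\<dots> \<le> (\<Sum>i\<le>j. n - K + (if i = 0 then 1 else 0))"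
      unfolding truncated_wt_def
    proof (intro sum_mono)
      fix i
      have "{c. c < n \<and> fls_nth (v $ c) (int i) \<noteq> 0} \<subseteq> ({..<n} - S) \<union> (if i = 0 then {c0} else {})"
        using vS[of _ i] by (cases "i = 0") auto
      then have "hamming_wt (coeff_vec v (int i)) \<le> card (({..<n} - S) \<union> (if i = 0 then {c0} else {}))"
        unfolding hamming_wt_def
        by (intro card_mono) (auto simp: coeff_vec_def dim)
      also have "\<dots> \<le> card ({..<n} - S) + card (if i = 0 then {c0} else {})"
        by (rule card_Un_le)
      also have "\<dots> = n - K + (if i = 0 then 1 else 0)"
        using S fin by (simp add: card_Diff_subset)
      finally show "hamming_wt (coeff_vec v (int i)) \<le> n - K + (if i = 0 then 1 else 0)" .
    qed
    also have "\<dots> = (j + 1) * (n - K) + 1"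
      by (simp add: sum.distrib)
    finally show ?thesis .
  qed
  then have "int (column_distance p n C j) \<le> int ((j + 1) * (n - K) + 1)"
    by (simp only: of_nat_le_iff)
  also have "\<dots> = (int j + 1) * (int n - (\<Sum>i<r. int (ks i))) + 1"
    using \<open>K \<le> n\<close> by (simp add: K_def distrib_right add.commute)
  finally show "int (column_distance p n C j) \<le> (int j + 1) * (int n - (\<Sum>i<r. int (ks i))) + 1" .
qed

end
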